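(* For every integer $n\ge 7$, $3\le \dim_{ms}(P_n\boxtimes P_n)\le 4$.
   Context: $P_n$ is the path on $n$ vertices. The strong product $G\boxtimes H$ has vertex set $V(G)\times V(H)$, with $(g,h)$ and $(g',h')$ adjacent iff ($g=g'$ and $hh'\in E(H)$) or ($gg'\in E(G)$ and $h=h'$) or ($gg'\in E(G)$ and $hh'\in E(H)$). For a connected graph $G$ with distance $d_G$, $u\in V(G)$ and $W=\{w_1,\dots,w_t\}\subseteq V(G)$, $\mathrm{m}_G(u|W)=\{\!\{d_G(u,w_1),\dots,d_G(u,w_t)\}\!\}$ (a multiset). $W$ is a multiset resolving set if the multisets $\mathrm{m}_G(u|W)$, $u\in V(G)$, are pairwise distinct; $\dim_{ms}(G)$ is the minimum cardinality of a multiset resolving set ($\infty$ if none exists). *)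

theory Defs
  imports
    "Graph_Theory.Graph_Theory"
    "HOL-Library.Multiset"
    "HOL-Library.Extended_Nat"
begin

text \<open>
  A finite simple graph is a \<^locale>\<open>pair_graph\<close>: a finite, loop-free digraph without parallel
  arcs whose arc relation is symmetric, each edge being represented by its two orientations.
\<close>

definition path_graph :: "nat \<Rightarrow> nat pair_pre_digraph" where
  "path_graph n =
     \<lparr> pverts = {..<n},
       parcs = {(i, j). i < n \<and> j < n \<and> (j = Suc i \<or> i = Suc j)} \<rparr>"

definition strong_product ::
  "'a pair_pre_digraph \<Rightarrow> 'b pair_pre_digraph \<Rightarrow> ('a \<times> 'b) pair_pre_digraph" where
  "strong_product G H =
     \<lparr> pverts = pverts G \<times> pverts H,
       parcs = {((g, h), (g', h')).
          (g, h) \<in> pverts G \<times> pverts H \<and> (g', h') \<in> pverts G \<times> pverts H \<and>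
          (g = g' \<and> (h, h') \<in> parcs H \<or>
           (g, g') \<in> parcs G \<and> h = h' \<or>
           (g, g') \<in> parcs G \<and> (h, h') \<in> parcs H)} \<rparr>"

text \<open>
  With unit weights, \<^const>\<open>wf_digraph.\<mu>\<close> is the length of a shortest walk, and it is infinite
  when there is no walk.
\<close>

definition graph_dist :: "'a pair_pre_digraph \<Rightarrow> 'a \<Rightarrow> 'a \<Rightarrow> ereal" where
  "graph_dist G u v = wf_digraph.\<mu> (with_proj G) (\<lambda>_. 1) u v"

definition multiset_repr :: "'a pair_pre_digraph \<Rightarrow> 'a \<Rightarrow> 'a set \<Rightarrow> ereal multiset" where
  "multiset_repr G u W = image_mset (graph_dist G u) (mset_set W)"

text \<open>
  Finiteness of \<open>W\<close> is automatic in a finite graph. It is stated because \<^const>\<open>mset_set\<close> and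
  \<^const>\<open>card\<close> are trivial on infinite sets.
\<close>

definition multiset_resolving_set :: "'a pair_pre_digraph \<Rightarrow> 'a set \<Rightarrow> bool" where
  "multiset_resolving_set G W \<longleftrightarrow>
     W \<subseteq> pverts G \<and> finite W \<and> inj_on (\<lambda>u. multiset_repr G u W) (pverts G)"

text \<open>The infimum of the empty set in \<^typ>\<open>enat\<close> is \<open>\<infinity>\<close>.\<close>

definition dim_ms :: "'a pair_pre_digraph \<Rightarrow> enat" where
  "dim_ms G = (INF W \<in> {W. multiset_resolving_set G W}. enat (card W))"

lemma pair_graph_path_graph: "pair_graph (path_graph n)"
proof
  show "finite (parcs (path_graph n))"
    by (rule finite_subset[of _ "{..<n} \<times> {..<n}"]) (auto simp: path_graph_def)
qed (auto simp: path_graph_def symmetric_def sym_def)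

lemma pair_graph_strong_product:
  assumes "pair_graph G" "pair_graph H"
  shows "pair_graph (strong_product G H)"
proof -
  interpret G: pair_graph G by fact
  interpret H: pair_graph H by fact
  have sym: "sym (parcs G)" "sym (parcs H)"
    using G.pair_sym_arcs H.pair_sym_arcs by (auto simp: symmetric_def)
  have fin: "finite (pverts G \<times> pverts H)"
    using G.pair_finite_verts H.pair_finite_verts by simp
  show ?thesis
  proof
    show "finite (parcs (strong_product G H))"
      by (rule finite_subset[OF _ finite_cartesian_product[OF fin fin]])
         (auto simp: strong_product_def)
    show "finite (pverts (strong_product G H))"
      using fin by (simp add: strong_product_def)
    show "symmetric (strong_product G H)"
      using sym by (auto simp: strong_product_def symmetric_def sym_def)
    show "fst e \<noteq> snd e" if "e \<in> parcs (strong_product G H)" for e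
      using that G.pair_no_loops H.pair_no_loops by (fastforce simp: strong_product_def)
  qed (auto simp: strong_product_def)
qed

lemma graph_dist_eq_INF:
  assumes "pair_graph G"
  shows "graph_dist G u v = (INF p \<in> {p. pre_digraph.awalk G u p v}. ereal (length p))"
proof -
  interpret pair_graph G by fact
  have "awalk_cost (\<lambda>_. 1) p = real (length p)" for p :: "('a \<times> 'a) list"
    by (induction p) simp_all
  then show ?thesis
    by (simp add: graph_dist_def \<mu>_def)
qed

end

(* Distances in the strong product of two paths are Chebyshev distances. A pair of landmarks
   {v, w} cannot separate v from w, and one landmark does not separate a horizontal from a
   vertical neighbour of itself; this gives the lower bound. For the upper bound let m = n - 1.
   The landmarks (0, m) and (m, 0) have distances {x, y} or {m - x, m - y} to (x, y), depending
   on the side of the antidiagonal x + y = m. Two further landmarks next to each other near the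
   corner (0, 0) reveal the side of the diagonal x = y. Inside each of the resulting triangles
   all distances are linear in x and y, so comparing multisets is linear arithmetic plus one
   parity obstruction; hence the landmarks near the corner depend on the parity of n. *)

theory Submission
  imports Defs
begin

section \<open>Graph distance and the Chebyshev metric on the grid\<close>

text \<open>\<open>f\<close> certifies the distance to \<open>v\<close>: it drops by at most one
  along an arc, so no walk from \<open>x\<close> to \<open>v\<close> is shorter than
  \<open>f x\<close>; and wherever it is positive some arc lowers it by one, so descending to zero
  gives a walk of length exactly \<open>f x\<close>.\<close>

lemma graph_dist_eqI:
  fixes f :: "'a \<Rightarrow> nat"
  assumes G: "pair_graph G" and "u \<in> pverts G"
    and target: "f v = 0"
    and zero: "\<And>x. x \<in> pverts G \<Longrightarrow> f x = 0 \<Longrightarrow> x = v"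
    and lipschitz: "\<And>x y. (x, y) \<in> parcs G \<Longrightarrow> f x \<le> Suc (f y)"
    and descent: "\<And>x k. x \<in> pverts G \<Longrightarrow> f x = Suc k \<Longrightarrow> \<exists>y. (x, y) \<in> parcs G \<and> f y = k"
  shows "graph_dist G u v = ereal (real (f u))"
proof -
  interpret pair_graph G by fact
  have lower: "f x \<le> length p" if "awalk x p v" for x p
    using that
  proof (induction p arbitrary: x)
    case Nil
    then show ?case using target by (simp add: awalk_Nil_iff)
  next
    case (Cons e p)
    then have "e \<in> parcs G" "x = fst e" "awalk (snd e) p v"
      by (auto simp: awalk_Cons_iff)
    with Cons.IH[of "snd e"] lipschitz[of "fst e" "snd e"] show ?case by simp
  qed
  have upper: "\<exists>p. awalk x p v \<and> length p = k" if "x \<in> pverts G" "f x = k" for x k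
    using that
  proof (induction k arbitrary: x)
    case 0
    then have "x = v" using zero by simp
    with 0 show ?case by (intro exI[of _ "[]"]) (simp add: awalk_Nil_iff)
  next
    case (Suc k)
    then obtain y where y: "(x, y) \<in> parcs G" "f y = k" using descent by blast
    then have "y \<in> pverts G" using in_arcsD2 by auto
    with y Suc.IH obtain p where "awalk y p v" "length p = k" by blast
    with y(1) show ?case by (intro exI[of _ "(x, y) # p"]) (simp add: awalk_Cons_iff)
  qed
  obtain p where p: "awalk u p v" "length p = f u" using upper \<open>u \<in> pverts G\<close> by blast
  show ?thesis
    unfolding graph_dist_eq_INF[OF G]
  proof (rule antisym)
    show "(INF p\<in>{p. awalk u p v}. ereal (length p)) \<le> ereal (f u)"
      using p by (intro INF_lower2[of p]) auto
    show "ereal (f u) \<le> (INF p\<in>{p. awalk u p v}. ereal (length p))"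
      using lower by (intro INF_greatest) auto
  qed
qed

abbreviation grid :: "nat \<Rightarrow> (nat \<times> nat) pair_pre_digraph" where
  "grid n \<equiv> strong_product (path_graph n) (path_graph n)"

text \<open>Absolute difference on \<open>nat\<close>: by truncation at least one summand is
  zero.\<close>

definition ndist :: "nat \<Rightarrow> nat \<Rightarrow> nat" where
  "ndist a b = (a - b) + (b - a)"

definition chebyshev :: "nat \<times> nat \<Rightarrow> nat \<times> nat \<Rightarrow> nat" where
  "chebyshev u v = max (ndist (fst u) (fst v)) (ndist (snd u) (snd v))"

lemma chebyshev_commute: "chebyshev u v = chebyshev v u"
  by (simp add: chebyshev_def ndist_def add.commute)

lemma chebyshev_self [simp]: "chebyshev u u = 0"
  by (simp add: chebyshev_def ndist_def)

lemma pverts_grid: "pverts (grid n) = {..<n} \<times> {..<n}"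
  by (simp add: strong_product_def path_graph_def)

text \<open>In a path, being equal or adjacent means differing by at most one. The three kinds of
  product edges are all combinations of these options except equality in both coordinates: king
  moves.\<close>

lemma parcs_grid:
  "((x, y), (x', y')) \<in> parcs (grid n) \<longleftrightarrow>
     x < n \<and> y < n \<and> x' < n \<and> y' < n \<and> (x, y) \<noteq> (x', y') \<and>
     ndist x x' \<le> 1 \<and> ndist y y' \<le> 1"
proof -
  have path: "(i, j) \<in> parcs (path_graph n) \<longleftrightarrow> i < n \<and> j < n \<and> ndist i j = 1" for i j
    by (auto simp: path_graph_def ndist_def)
  have le1: "ndist i j \<le> 1 \<longleftrightarrow> i = j \<or> ndist i j = 1" for i j
    by (auto simp: ndist_def)
  have neq: "ndist i j = 1 \<Longrightarrow> i \<noteq> j" for i j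
    by (auto simp: ndist_def)
  have verts: "pverts (path_graph n) = {..<n}"
    by (simp add: path_graph_def)
  show ?thesis
    unfolding strong_product_def pair_pre_digraph.simps mem_Collect_eq prod.case path le1 verts
    using neq by blast
qed

text \<open>For \<open>a = c\<close> the choice is \<open>a' = a\<close>, and
  \<open>0 - 1 = 0\<close> keeps the equation true, so a coordinate that already agrees can
  stay.\<close>

lemma ndist_step:
  assumes "a < n" "c < n"
  obtains a' where "a' < n" "ndist a a' \<le> 1" "ndist a' c = ndist a c - 1"
proof
  let ?a' = "if a < c then a + 1 else if c < a then a - 1 else a"
  show "?a' < n" "ndist a ?a' \<le> 1" "ndist ?a' c = ndist a c - 1"
    using assms by (auto simp: ndist_def)
qed

lemma graph_dist_grid:
  assumes "u \<in> pverts (grid n)" "v \<in> pverts (grid n)"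
  shows "graph_dist (grid n) u v = ereal (real (chebyshev u v))"
proof (rule graph_dist_eqI[where f = "\<lambda>x. chebyshev x v"])
  obtain a b where v: "v = (a, b)" "a < n" "b < n" using assms by (auto simp: pverts_grid)
  show "pair_graph (grid n)"
    by (intro pair_graph_strong_product pair_graph_path_graph)
  show "x = v" if "chebyshev x v = 0" for x
    using that v by (cases x) (auto simp: chebyshev_def ndist_def)
  show "chebyshev x v \<le> Suc (chebyshev y v)" if "(x, y) \<in> parcs (grid n)" for x y
  proof -
    have tri: "ndist s a \<le> Suc (ndist t a)" if "ndist s t \<le> 1" for s t a
      using that by (simp add: ndist_def)
    obtain s t s' t' where "x = (s, t)" "y = (s', t')" by fastforce
    with that v tri[of s s' a] tri[of t t' b] show ?thesis
      by (auto simp: parcs_grid chebyshev_def le_max_iff_disj)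
  qed
  show "\<exists>y. (x, y) \<in> parcs (grid n) \<and> chebyshev y v = k"
    if x: "x \<in> pverts (grid n)" "chebyshev x v = Suc k" for x k
  proof -
    obtain s t where st: "x = (s, t)" "s < n" "t < n" using x by (auto simp: pverts_grid)
    obtain s' where s': "s' < n" "ndist s s' \<le> 1" "ndist s' a = ndist s a - 1"
      using ndist_step st v by metis
    obtain t' where t': "t' < n" "ndist t t' \<le> 1" "ndist t' b = ndist t b - 1"
      using ndist_step st v by metis
    \<comment> \<open>Both positive coordinate distances shrink in one move, so the maximum
      \<open>Suc k\<close> drops to \<open>k\<close>; a zero distance stays zero.\<close>
    have k: "chebyshev (s', t') v = k"
      using s' t' x(2) st v by (simp add: chebyshev_def)
    with x have "(s', t') \<noteq> x" by auto
    with s' t' st k show ?thesis by (intro exI[of _ "(s', t')"]) (auto simp: parcs_grid)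
  qed
qed (use assms in auto)

section \<open>Resolving sets in terms of distances in \<open>nat\<close>\<close>

lemma multiset_repr_grid:
  assumes "u \<in> pverts (grid n)" "W \<subseteq> pverts (grid n)" "finite W"
  shows "multiset_repr (grid n) u W =
    image_mset (\<lambda>k. ereal (real k)) (image_mset (chebyshev u) (mset_set W))"
  unfolding multiset_repr_def multiset.map_comp comp_def
  using assms by (intro image_mset_cong graph_dist_grid) auto

text \<open>The embedding of \<open>nat\<close> into \<open>ereal\<close> is injective, hence so is
  the map it induces on multisets.\<close>

lemma multiset_resolving_set_grid:
  "multiset_resolving_set (grid n) W \<longleftrightarrow>
     W \<subseteq> pverts (grid n) \<and> finite W \<and>
     inj_on (\<lambda>u. image_mset (chebyshev u) (mset_set W)) (pverts (grid n))"
proof -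
  have inj: "inj (image_mset (\<lambda>k::nat. ereal (real k)))"
    by (intro multiset.inj_map) (simp add: inj_on_def)
  have "inj_on (\<lambda>u. multiset_repr (grid n) u W) (pverts (grid n)) \<longleftrightarrow>
      inj_on (\<lambda>u. image_mset (chebyshev u) (mset_set W)) (pverts (grid n))"
    if W: "W \<subseteq> pverts (grid n)" "finite W"
    unfolding inj_on_def by (simp only: multiset_repr_grid[OF _ W] inj_eq[OF inj] cong: ball_cong)
  then show ?thesis by (auto simp: multiset_resolving_set_def)
qed

section \<open>Lower bound: at most two landmarks never suffice\<close>

lemma card_multiset_resolving_set_grid:
  assumes "n \<ge> 2" and W: "multiset_resolving_set (grid n) W"
  shows "card W \<ge> 3"
proof (rule ccontr)
  define r where "r = (\<lambda>u. image_mset (chebyshev u) (mset_set W))"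
  have sub: "W \<subseteq> pverts (grid n)" and fin: "finite W" and inj: "inj_on r (pverts (grid n))"
    using W by (auto simp: multiset_resolving_set_grid r_def)
  assume "\<not> card W \<ge> 3"
  then consider "card W = 0" | "card W = 1" | "card W = 2" by linarith
  then show False
  proof cases
    case 1
    then have "r (0, 0) = r (1, 1)" using fin by (simp add: r_def)
    with inj_onD[OF inj, of "(0, 0)" "(1, 1)"] \<open>n \<ge> 2\<close> show False
      by (simp add: pverts_grid)
  next
    case 2
    then obtain a b where ab: "W = {(a, b)}" by (metis card_1_singletonE surj_pair)
    \<comment> \<open>\<open>s k\<close> is adjacent to \<open>k\<close>. Stepping up only from 0
      keeps it below \<open>n\<close>, as \<open>n \<ge> 2\<close>. Both shifted vertices have
      distance 1 from the landmark.\<close>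
    define s where "s k = (if k = 0 then 1 else k - 1)" for k :: nat
    have "r (s a, b) = r (a, s b)"
      by (simp add: r_def ab chebyshev_def ndist_def s_def)
    moreover have "(s a, b) \<in> pverts (grid n)" "(a, s b) \<in> pverts (grid n)"
      using sub ab \<open>n \<ge> 2\<close> by (auto simp: pverts_grid s_def)
    moreover have "(s a, b) \<noteq> (a, s b)" by (simp add: s_def)
    ultimately show False using inj by (meson inj_onD)
  next
    case 3
    then obtain v w where vw: "W = {v, w}" "v \<noteq> w" by (meson card_2_iff)
    \<comment> \<open>Both multisets consist of 0 and the distance between \<open>v\<close> and
      \<open>w\<close>.\<close>
    then have "r v = r w" by (simp add: r_def chebyshev_commute add_mset_commute)
    with inj vw sub show False by (auto simp: inj_on_def)
  qed
qed

section \<open>Equality of small multisets as a choice of matching\<close>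

lemma mset2_eqD: "{#a, b#} = {#a', b'#} \<Longrightarrow> a = a' \<and> b = b' \<or> a = b' \<and> b = a'"
  by (auto simp: add_eq_conv_ex)

lemma mset3_eqD:
  assumes "{#a, b, c#} = {#a', b', c'#}"
  shows "a = a' \<and> {#b, c#} = {#b', c'#} \<or> a = b' \<and> {#b, c#} = {#a', c'#} \<or>
    a = c' \<and> {#b, c#} = {#a', b'#}"
proof -
  have "a \<in># {#a', b', c'#}" using assms by (metis union_single_eq_member)
  then consider "a = a'" | "a = b'" | "a = c'" by auto
  then show ?thesis using assms by cases (simp_all add: add_mset_commute)
qed

lemma mset4_eqD:
  assumes "{#a, b, c, d#} = {#a', b', c', d'#}"
  shows "a = a' \<and> {#b, c, d#} = {#b', c', d'#} \<or> a = b' \<and> {#b, c, d#} = {#a', c', d'#} \<or>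
    a = c' \<and> {#b, c, d#} = {#a', b', d'#} \<or> a = d' \<and> {#b, c, d#} = {#a', b', c'#}"
proof -
  have "a \<in># {#a', b', c', d'#}" using assms by (metis union_single_eq_member)
  then consider "a = a'" | "a = b'" | "a = c'" | "a = d'" by auto
  then show ?thesis using assms by cases (simp_all add: add_mset_commute)
qed

text \<open>Applied in succession, these fix the partner of the first entry and cancel it, so an
  equation of four-element multisets splits into 24 matchings.\<close>

lemmas mset_eqEs = mset4_eqD[elim_format] mset3_eqD[elim_format] mset2_eqD[elim_format]

section \<open>Distance multisets for four landmarks\<close>

text \<open>\<open>odd\<close> refers to the side length \<open>n = m + 1\<close>. The landmarks are
  \<open>(0, m)\<close>, \<open>(m, 0)\<close>, \<open>(0, 0)\<close>, \<open>(0, 1)\<close>. Away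
  from the origin the last two distances agree if \<open>y \<le> x\<close> and differ by one if
  \<open>x < y\<close>.\<close>

definition odd_grid_repr :: "nat \<Rightarrow> nat \<Rightarrow> nat \<Rightarrow> nat multiset" where
  "odd_grid_repr m x y = {#max x (m - y), max (m - x) y, max x y, max x (ndist y 1)#}"

text \<open>The landmarks are \<open>(0, m)\<close>, \<open>(m, 0)\<close>, \<open>(1, 0)\<close>,
  \<open>(1, 1)\<close>. Moving the adjacent pair changes the parity of \<open>m\<close> at which
  collisions occur.\<close>

definition even_grid_repr :: "nat \<Rightarrow> nat \<Rightarrow> nat \<Rightarrow> nat multiset" where
  "even_grid_repr m x y =
     {#max x (m - y), max (m - x) y, max (ndist x 1) y, max (ndist x 1) (ndist y 1)#}"

text \<open>The two diagonals cut the grid into four triangles on which each maximum is attained by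
  a fixed term; the origin is separate because 0 has distance 1 from 1. The variables
  \<open>p\<close>, \<open>q\<close>, \<open>z\<close> stand for \<open>m - x\<close>,
  \<open>m - y\<close>, \<open>y - 1\<close>, with additive equations in place of truncated
  subtraction, and \<open>x \<le> q\<close> says \<open>x + y \<le> m\<close>.\<close>

lemma odd_grid_repr_cases:
  assumes "M = odd_grid_repr m x y" "x \<le> m" "y \<le> m"
  obtains "x = 0" "y = 0" "M = {#m, m, 0, 1#}"
  | p q where "x > 0" "y \<le> x" "x \<le> q" "x + p = m" "y + q = m" "M = {#q, p, x, x#}"
  | "x > 0" "y \<le> x" "x + y > m" "M = {#x, y, x, x#}"
  | p q z where "x < y" "x \<le> q" "x + p = m" "y + q = m" "y = Suc z" "M = {#q, p, y, z#}"
  | z where "x < y" "x + y > m" "y = Suc z" "M = {#x, y, y, z#}"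
proof -
  consider "x = 0" "y = 0" | "x > 0" "y \<le> x" "x + y \<le> m" | "x > 0" "y \<le> x" "x + y > m"
    | "x < y" "x + y \<le> m" | "x < y" "x + y > m"
    by linarith
  then show thesis
  proof cases
    case 1
    with assms show thesis by (intro that(1)) (simp_all add: odd_grid_repr_def ndist_def)
  next
    case 2
    then have "max x (m - y) = m - y" "max (m - x) y = m - x" "max x y = x" "max x (ndist y 1) = x"
      by (auto simp: ndist_def)
    with 2 assms show thesis by (intro that(2)[of "m - y" "m - x"]) (simp_all add: odd_grid_repr_def)
  next
    case 3
    then have "max x (m - y) = x" "max (m - x) y = y" "max x y = x" "max x (ndist y 1) = x"
      by (auto simp: ndist_def)
    with 3 assms show thesis by (intro that(3)) (simp_all add: odd_grid_repr_def)
  next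
    case 4
    then have "max x (m - y) = m - y" "max (m - x) y = m - x" "max x y = y"
      "max x (ndist y 1) = y - 1"
      by (auto simp: ndist_def)
    with 4 assms show thesis
      by (intro that(4)[of "m - y" "m - x" "y - 1"]) (simp_all add: odd_grid_repr_def)
  next
    case 5
    then have "max x (m - y) = x" "max (m - x) y = y" "max x y = y"
      "max x (ndist y 1) = y - 1"
      by (auto simp: ndist_def)
    with 5 assms show thesis by (intro that(5)[of "y - 1"]) (simp_all add: odd_grid_repr_def)
  qed
qed

text \<open>Each pair of regions and each matching of entries gives a linear system that is
  contradictory or forces equal coordinates. The bound on \<open>m\<close> excludes
  \<open>m = 2\<close>, where \<open>(0, 0)\<close> and \<open>(0, 2)\<close> share
  \<open>{#0, 1, 2, 2#}\<close>.\<close>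

lemma odd_grid_repr_inj:
  assumes x: "M = odd_grid_repr m x y" "x \<le> m" "y \<le> m"
    and x': "M = odd_grid_repr m x' y'" "x' \<le> m" "y' \<le> m"
    and m: "m \<ge> 4" "even m"
  shows "x = x' \<and> y = y'"
proof -
  \<comment> \<open>For \<open>m = 2 * x + 1\<close> and \<open>y \<le> x\<close>, the vertices
    \<open>(x, y)\<close> and \<open>(y, x + 1)\<close> would have the same multiset.\<close>
  have parity: "m \<noteq> 2 * x + 1" "m \<noteq> 2 * x' + 1" using m by auto
  show ?thesis
    using x
  proof (cases rule: odd_grid_repr_cases)
    case 1
    show ?thesis
      by (cases rule: odd_grid_repr_cases[OF x'[unfolded 1(3)]];
          elim mset_eqEs disjE conjE; intro conjI;
          (use 1(1-2) m x(2-3) x'(2-3) in linarith | use 1(1-2) parity in linarith))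
  next
    case 2
    show ?thesis
      by (cases rule: odd_grid_repr_cases[OF x'[unfolded 2(6)]];
          elim mset_eqEs disjE conjE; intro conjI;
          (use 2(1-5) m x(2-3) x'(2-3) in linarith | use 2(1-5) parity in linarith))
  next
    case 3
    show ?thesis
      by (cases rule: odd_grid_repr_cases[OF x'[unfolded 3(4)]];
          elim mset_eqEs disjE conjE; intro conjI;
          (use 3(1-3) m x(2-3) x'(2-3) in linarith | use 3(1-3) parity in linarith))
  next
    case 4
    show ?thesis
      by (cases rule: odd_grid_repr_cases[OF x'[unfolded 4(6)]];
          elim mset_eqEs disjE conjE; intro conjI;
          (use 4(1-5) m x(2-3) x'(2-3) in linarith | use 4(1-5) parity in linarith))
  next
    case 5
    show ?thesis
      by (cases rule: odd_grid_repr_cases[OF x'[unfolded 5(4)]];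
          elim mset_eqEs disjE conjE; intro conjI;
          (use 5(1-3) m x(2-3) x'(2-3) in linarith | use 5(1-3) parity in linarith))
  qed
qed

text \<open>
  The vertices (0, 0), (1, 0), (0, 1) are separate cases because the distance of a coordinate 0
  to 1 is not obtained by subtracting 1.
\<close>

lemma even_grid_repr_cases:
  assumes "M = even_grid_repr m x y" "x \<le> m" "y \<le> m" "m \<ge> 5"
  obtains "x = 0" "y = 0" "M = {#m, m, 1, 1#}"
  | p where "x = 1" "y = 0" "m = Suc p" "M = {#m, p, 0, 1#}"
  | p where "x = 0" "y = 1" "m = Suc p" "M = {#p, m, 1, 1#}"
  | p q z where "y < x" "x > 1" "x \<le> q" "x + p = m" "y + q = m" "x = Suc z" "M = {#q, p, z, z#}"
  | z where "y < x" "x + y > m" "x = Suc z" "M = {#x, y, z, z#}"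
  | p q z where "x \<le> y" "x + y > 1" "x \<le> q" "x + p = m" "y + q = m" "y = Suc z"
      "M = {#q, p, y, z#}"
  | z where "x \<le> y" "x + y > m" "y = Suc z" "M = {#x, y, y, z#}"
proof -
  consider "x = 0" "y = 0" | "x = 1" "y = 0" | "x = 0" "y = 1"
    | "y < x" "x > 1" "x + y \<le> m" | "y < x" "x + y > m"
    | "x \<le> y" "x + y > 1" "x + y \<le> m" | "x \<le> y" "x + y > m"
    by linarith
  then show thesis
  proof cases
    case 1
    with assms show thesis by (intro that(1)) (simp_all add: even_grid_repr_def ndist_def)
  next
    case 2
    with assms show thesis by (intro that(2)[of "m - 1"]) (simp_all add: even_grid_repr_def ndist_def)
  next
    case 3
    with assms show thesis by (intro that(3)[of "m - 1"]) (simp_all add: even_grid_repr_def ndist_def)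
  next
    case 4
    then have "max x (m - y) = m - y" "max (m - x) y = m - x" "max (ndist x 1) y = x - 1"
      "max (ndist x 1) (ndist y 1) = x - 1"
      by (auto simp: ndist_def)
    with 4 assms show thesis
      by (intro that(4)[of "m - y" "m - x" "x - 1"]) (simp_all add: even_grid_repr_def)
  next
    case 5
    then have "max x (m - y) = x" "max (m - x) y = y" "max (ndist x 1) y = x - 1"
      "max (ndist x 1) (ndist y 1) = x - 1"
      using assms by (auto simp: ndist_def)
    with 5 assms show thesis by (intro that(5)[of "x - 1"]) (simp_all add: even_grid_repr_def)
  next
    case 6
    then have "max x (m - y) = m - y" "max (m - x) y = m - x" "max (ndist x 1) y = y"
      "max (ndist x 1) (ndist y 1) = y - 1" "y > 0"
      by (auto simp: ndist_def)
    with 6 assms show thesis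
      by (intro that(6)[of "m - y" "m - x" "y - 1"]) (simp_all add: even_grid_repr_def)
  next
    case 7
    then have "max x (m - y) = x" "max (m - x) y = y" "max (ndist x 1) y = y"
      "max (ndist x 1) (ndist y 1) = y - 1"
      using assms unfolding ndist_def by linarith+
    with 7 assms show thesis by (intro that(7)[of "y - 1"]) (simp_all add: even_grid_repr_def)
  qed
qed

text \<open>Same comparison of regions, now seven. The bound on \<open>m\<close> excludes
  \<open>m = 3\<close>, where \<open>(0, 1)\<close> and \<open>(0, 2)\<close> share
  \<open>{#1, 1, 2, 3#}\<close>.\<close>

lemma even_grid_repr_inj:
  assumes x: "M = even_grid_repr m x y" "x \<le> m" "y \<le> m"
    and x': "M = even_grid_repr m x' y'" "x' \<le> m" "y' \<le> m"
    and m: "m \<ge> 5" "odd m"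
  shows "x = x' \<and> y = y'"
proof -
  \<comment> \<open>For \<open>m = 2 * y\<close> and \<open>x < y\<close>, the vertices
    \<open>(x, y)\<close> and \<open>(y + 1, x)\<close> would have the same multiset.\<close>
  have parity: "m \<noteq> 2 * y" "m \<noteq> 2 * y'" using m by auto
  show ?thesis
    using x m(1)
  proof (cases rule: even_grid_repr_cases)
    case 1
    show ?thesis
      by (cases rule: even_grid_repr_cases[OF x'[unfolded 1(3)] m(1)];
          elim mset_eqEs disjE conjE; intro conjI;
          (use 1(1-2) m x(2-3) x'(2-3) in linarith | use 1(1-2) parity in linarith))
  next
    case 2
    show ?thesis
      by (cases rule: even_grid_repr_cases[OF x'[unfolded 2(4)] m(1)];
          elim mset_eqEs disjE conjE; intro conjI;
          (use 2(1-3) m x(2-3) x'(2-3) in linarith | use 2(1-3) parity in linarith))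
  next
    case 3
    show ?thesis
      by (cases rule: even_grid_repr_cases[OF x'[unfolded 3(4)] m(1)];
          elim mset_eqEs disjE conjE; intro conjI;
          (use 3(1-3) m x(2-3) x'(2-3) in linarith | use 3(1-3) parity in linarith))
  next
    case 4
    show ?thesis
      by (cases rule: even_grid_repr_cases[OF x'[unfolded 4(7)] m(1)];
          elim mset_eqEs disjE conjE; intro conjI;
          (use 4(1-6) m x(2-3) x'(2-3) in linarith | use 4(1-6) parity in linarith))
  next
    case 5
    show ?thesis
      by (cases rule: even_grid_repr_cases[OF x'[unfolded 5(4)] m(1)];
          elim mset_eqEs disjE conjE; intro conjI;
          (use 5(1-3) m x(2-3) x'(2-3) in linarith | use 5(1-3) parity in linarith))
  next
    case 6
    show ?thesis
      by (cases rule: even_grid_repr_cases[OF x'[unfolded 6(7)] m(1)];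
          elim mset_eqEs disjE conjE; intro conjI;
          (use 6(1-6) m x(2-3) x'(2-3) in linarith | use 6(1-6) parity in linarith))
  next
    case 7
    show ?thesis
      by (cases rule: even_grid_repr_cases[OF x'[unfolded 7(4)] m(1)];
          elim mset_eqEs disjE conjE; intro conjI;
          (use 7(1-3) m x(2-3) x'(2-3) in linarith | use 7(1-3) parity in linarith))
  qed
qed

section \<open>Upper bound: resolving sets with four landmarks\<close>

lemma resolving_set_grid4I:
  assumes "distinct [p, q, r, s]" "{p, q, r, s} \<subseteq> pverts (grid n)"
    and inj: "\<And>x y x' y'. \<lbrakk>x < n; y < n; x' < n; y' < n;
      {#chebyshev (x, y) p, chebyshev (x, y) q, chebyshev (x, y) r, chebyshev (x, y) s#} =
      {#chebyshev (x', y') p, chebyshev (x', y') q, chebyshev (x', y') r, chebyshev (x', y') s#}\<rbrakk>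
      \<Longrightarrow> x = x' \<and> y = y'"
  shows "multiset_resolving_set (grid n) {p, q, r, s}"
proof -
  \<comment> \<open>Distinctness ensures that each landmark contributes its own entry.\<close>
  have "mset_set {p, q, r, s} = {#p, q, r, s#}" using assms(1) by simp
  then show ?thesis
    using assms(2) inj by (auto simp: multiset_resolving_set_grid inj_on_def pverts_grid)
qed

lemma resolving_set_grid_odd:
  assumes "n \<ge> 5" "odd n"
  shows "multiset_resolving_set (grid n) {(0, n - 1), (n - 1, 0), (0, 0), (0, 1)}"
proof (rule resolving_set_grid4I)
  fix x y x' y' assume *: "x < n" "y < n" "x' < n" "y' < n"
    and eq: "{#chebyshev (x, y) (0, n - 1), chebyshev (x, y) (n - 1, 0),
        chebyshev (x, y) (0, 0), chebyshev (x, y) (0, 1)#} =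
      {#chebyshev (x', y') (0, n - 1), chebyshev (x', y') (n - 1, 0),
        chebyshev (x', y') (0, 0), chebyshev (x', y') (0, 1)#}"
  \<comment> \<open>Coordinates are at most \<open>n - 1\<close>, so their distance to
    \<open>n - 1\<close> is a plain difference.\<close>
  have "{#chebyshev (x, y) (0, n - 1), chebyshev (x, y) (n - 1, 0), chebyshev (x, y) (0, 0),
      chebyshev (x, y) (0, 1)#} = odd_grid_repr (n - 1) x y" if "x < n" "y < n" for x y
    using that by (simp add: odd_grid_repr_def chebyshev_def ndist_def)
  with eq * have eq': "odd_grid_repr (n - 1) x y = odd_grid_repr (n - 1) x' y'" by simp
  with * assms show "x = x' \<and> y = y'" by (intro odd_grid_repr_inj[OF refl _ _ eq']) auto
qed (use assms in \<open>auto simp: pverts_grid\<close>)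

lemma resolving_set_grid_even:
  assumes "n \<ge> 6" "even n"
  shows "multiset_resolving_set (grid n) {(0, n - 1), (n - 1, 0), (1, 0), (1, 1)}"
proof (rule resolving_set_grid4I)
  fix x y x' y' assume *: "x < n" "y < n" "x' < n" "y' < n"
    and eq: "{#chebyshev (x, y) (0, n - 1), chebyshev (x, y) (n - 1, 0),
        chebyshev (x, y) (1, 0), chebyshev (x, y) (1, 1)#} =
      {#chebyshev (x', y') (0, n - 1), chebyshev (x', y') (n - 1, 0),
        chebyshev (x', y') (1, 0), chebyshev (x', y') (1, 1)#}"
  have "{#chebyshev (x, y) (0, n - 1), chebyshev (x, y) (n - 1, 0), chebyshev (x, y) (1, 0),
      chebyshev (x, y) (1, 1)#} = even_grid_repr (n - 1) x y" if "x < n" "y < n" for x y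
    using that by (simp add: even_grid_repr_def chebyshev_def ndist_def)
  with eq * have eq': "even_grid_repr (n - 1) x y = even_grid_repr (n - 1) x' y'" by simp
  with * assms show "x = x' \<and> y = y'" by (intro even_grid_repr_inj[OF refl _ _ eq']) auto
qed (use assms in \<open>auto simp: pverts_grid\<close>)

theorem theorem6:
  fixes n :: nat
  assumes "n \<ge> 7"
  shows "3 \<le> dim_ms (strong_product (path_graph n) (path_graph n)) \<and>
         dim_ms (strong_product (path_graph n) (path_graph n)) \<le> 4"
proof
  have "enat 3 \<le> enat (card W)" if "multiset_resolving_set (grid n) W" for W
    using card_multiset_resolving_set_grid[OF _ that] assms by simp
  then show "3 \<le> dim_ms (grid n)"
    unfolding dim_ms_def by (intro INF_greatest) (simp add: numeral_eq_enat)
  \<comment> \<open>The parity of \<open>n\<close> selects the landmarks near the corner;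
    \<open>n \<ge> 7\<close> covers the size bounds 5 and 6 of the two constructions.\<close>
  obtain W where W: "multiset_resolving_set (grid n) W" "card W \<le> 4"
  proof (cases "odd n")
    case True
    then show ?thesis
      using assms by (intro that[OF resolving_set_grid_odd]) (auto intro: card_insert_le_m1)
  next
    case False
    then show ?thesis
      using assms by (intro that[OF resolving_set_grid_even]) (auto intro: card_insert_le_m1)
  qed
  then have "dim_ms (grid n) \<le> enat (card W)"
    unfolding dim_ms_def by (intro INF_lower) simp
  also have "\<dots> \<le> 4" using W(2) by (simp add: numeral_eq_enat)
  finally show "dim_ms (grid n) \<le> 4" .
qed

end
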